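(* There exists an absolute constant $c_0>0$ such that for every integer $n\ge 1$ there exists an analytic trigonometric polynomial $P_n$ of degree $n$ on the torus $\mathbb{T}^2$ such that \[ \|D^2_{xx}P_n\|_\infty+\|D^2_{yy}P_n\|_\infty\leq 1 \] but \[ \|D^2_{xy}P_n\|_\infty \geq c_0\,(\log n)^{1/8}. \]
   Context: $\mathbb{T}^2=(\mathbb{R}/2\pi\mathbb{Z})^2$ with coordinates $(x,y)$. A trigonometric polynomial is a finite sum $f(x,y)=\sum_{k\in\mathbb{Z}^2}\widehat f(k)e^{i(k_1x+k_2y)}$ with complex coefficients. It is called analytic if $\widehat f(k)=0$ for all $k=(k_1,k_2)$ outside the set $\{k\in\mathbb{Z}^2: k_1\ge 0,\ k_2\ge 0\}$; equivalently, $f(x,y)=P(e^{ix},e^{iy})$ for a polynomial $P$ in two complex variables, and the degree of $f$ is the total degree of $P$. $D^2_{xx}, D^2_{yy}, D^2_{xy}$ denote the second order partial derivatives $\partial^2/\partial x^2$, $\partial^2/\partial y^2$, $\partial^2/\partial x\partial y$, and $\|\cdot\|_\infty$ is the supremum norm on $\mathbb{T}^2$. *)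

theory Defs
  imports "HOL-Analysis.Analysis" "HOL-Library.Poly_Mapping"
begin

text \<open>
  A trigonometric polynomial on the torus \<open>(\<real>/2\<pi>\<int>)\<^sup>2\<close> is given by its finitely supported family
  of Fourier coefficients, which the function it represents determines uniquely.  Functions on the
  torus are treated as doubly \<open>2\<pi>\<close>-periodic functions on the plane.
\<close>

type_synonym trig_poly = "(int \<times> int) \<Rightarrow>\<^sub>0 complex"

definition trig_fun :: "trig_poly \<Rightarrow> real \<times> real \<Rightarrow> complex" where
  "trig_fun P = (\<lambda>(x, y). \<Sum>(k1, k2)\<in>Poly_Mapping.keys P.
     Poly_Mapping.lookup P (k1, k2) * exp (\<i> * of_real (of_int k1 * x + of_int k2 * y)))"

definition analytic_trig_poly :: "trig_poly \<Rightarrow> bool" where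
  "analytic_trig_poly P \<longleftrightarrow>
     (\<forall>k1 k2. \<not> (0 \<le> k1 \<and> 0 \<le> k2) \<longrightarrow> Poly_Mapping.lookup P (k1, k2) = 0)"

text \<open>
  For analytic \<open>P\<close> this is the total degree of the polynomial \<open>Q\<close> in two variables
  with \<open>f(x, y) = Q(e\<^sup>i\<^sup>x, e\<^sup>i\<^sup>y)\<close>, where \<open>f\<close> is the function represented by \<open>P\<close>;
  inserting \<open>0\<close> only serves to give \<open>P = 0\<close> degree \<open>0\<close>.
\<close>

definition trig_degree :: "trig_poly \<Rightarrow> nat" where
  "trig_degree P = nat (Max (insert 0 ((\<lambda>(k1, k2). k1 + k2) ` Poly_Mapping.keys P)))"

definition partial_x :: "(real \<times> real \<Rightarrow> complex) \<Rightarrow> real \<times> real \<Rightarrow> complex" where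
  "partial_x f = (\<lambda>(x, y). vector_derivative (\<lambda>t. f (t, y)) (at x))"

definition partial_y :: "(real \<times> real \<Rightarrow> complex) \<Rightarrow> real \<times> real \<Rightarrow> complex" where
  "partial_y f = (\<lambda>(x, y). vector_derivative (\<lambda>t. f (x, t)) (at y))"

text \<open>
  By periodicity the supremum over the torus is the supremum over the plane.  The real-valued
  supremum is meaningful for bounded functions, hence for trigonometric polynomials and their
  derivatives.
\<close>

definition sup_norm :: "(real \<times> real \<Rightarrow> complex) \<Rightarrow> real" where
  "sup_norm f = (SUP p. norm (f p))"

end

theory Submission
  imports Defs
begin

text \<open>
  Since \<open>(1, 4) + (4, 1) = 5 (1, 1)\<close> while \<open>2 + 2 \<noteq> 5\<close>, the combination of the three characters
  of frequencies \<open>M (1, 2)\<close>, \<open>M (2, 1)\<close>, \<open>M (1, 1)\<close> with coefficients \<open>1\<close>, \<open>1\<close>, \<open>- 5\<close> has second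
  derivatives in \<open>x\<close> and in \<open>y\<close> that vanish at the origin, but its mixed derivative does not.  We sum
  \<open>N\<close> such combinations at the scales \<open>M = L\<^sup>j\<close>, normalised by \<open>M\<^sup>2\<close> and localised near the origin
  by the Riesz products \<open>R\<^sub>j = A\<^sub>j(x) A\<^sub>j(y)\<close> with \<open>A\<^sub>j(t) = \<Prod>i<j. (1 + cos (L\<^sup>i t)) / 2\<close>; the
  frequencies of \<open>R\<^sub>j\<close> are small compared with \<open>L\<^sup>j\<close>, so the sum stays analytic and differentiating
  \<open>R\<^sub>j\<close> costs only an error \<open>O(1 / L)\<close> per term.  The mixed derivative at the origin is exactly \<open>N\<close>.
  The pure derivatives are dominated by sums of \<open>A\<^sub>j |1 - e\<^bsup>i M t\<^esup>|\<close>, which are \<open>O(\<surd>N)\<close> by the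
  Cauchy-Schwarz inequality, because \<open>A\<^sub>j |1 - e\<^bsup>i M t\<^esup>|\<^sup>2 = 4 (A\<^sub>j - A\<^bsub>j+1\<^esub>)\<close> telescopes.  Taking
  \<open>L = 8\<^sup>N\<close> and \<open>8\<close> to the power \<open>N\<^sup>2\<close> comparable with \<open>n\<close> gives the growth \<open>\<surd>N\<close>, of order
  \<open>(log n)\<^bsup>1/4\<^esup>\<close>.  A small multiple of \<open>e\<^bsup>i n x\<^esup>\<close> makes the degree exactly \<open>n\<close> without affecting the
  mixed derivative.
\<close>

subsection \<open>Riesz products\<close>

text \<open>Normalised by peak value rather than by mean: each factor lies between 0 and 1 and
  equals 1 at the origin.\<close>

definition riesz :: "real \<Rightarrow> nat \<Rightarrow> real \<Rightarrow> real" where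
  "riesz L j t = (\<Prod>i<j. (1 + cos (L ^ i * t)) / 2)"

lemma riesz_0 [simp]: "riesz L 0 t = 1"
  by (simp add: riesz_def)

lemma riesz_Suc: "riesz L (Suc j) t = riesz L j t * ((1 + cos (L ^ j * t)) / 2)"
  by (simp add: riesz_def)

lemma half_one_plus_cos: "0 \<le> (1 + cos u) / 2" "(1 + cos u) / 2 \<le> (1 :: real)"
  using cos_ge_minus_one[of u] cos_le_one[of u] by (simp_all del: cos_ge_minus_one cos_le_one)

lemma riesz_nonneg: "0 \<le> riesz L j t"
  unfolding riesz_def by (intro prod_nonneg ballI half_one_plus_cos)

lemma riesz_le_1: "riesz L j t \<le> 1"
  unfolding riesz_def by (intro prod_le_1 conjI half_one_plus_cos)

lemma riesz_at_0 [simp]: "riesz L j 0 = 1"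
  by (simp add: riesz_def)

text \<open>The value \<open>2 - 2 * cos u\<close> is written so that the Riesz factor
  \<open>(1 + cos u) / 2\<close> is visible; multiplied by \<open>riesz L j t\<close> it becomes a
  difference of consecutive products.\<close>

lemma norm_one_minus_cis_sq: "(norm (1 - cis u))\<^sup>2 = 4 * (1 - (1 + cos u) / 2)"
proof -
  have "(norm (1 - cis u))\<^sup>2 = (1 - cos u)\<^sup>2 + (sin u)\<^sup>2"
    by (simp add: cmod_power2)
  also have "\<dots> = 4 * (1 - (1 + cos u) / 2)"
    using sin_cos_squared_add[of u] by (simp add: power2_diff algebra_simps)
  finally show ?thesis .
qed

lemma sum_riesz_norm_one_minus_cis_le:
  "(\<Sum>j<N. riesz L j t * norm (1 - cis (L ^ j * t))) \<le> 2 * sqrt N"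
proof -
  let ?a = "\<lambda>j. riesz L j t * norm (1 - cis (L ^ j * t))"
  have sq: "(?a j)\<^sup>2 \<le> 4 * (riesz L j t - riesz L (Suc j) t)" for j
  proof -
    have "(?a j)\<^sup>2 = riesz L j t * (riesz L j t * (4 * (1 - (1 + cos (L ^ j * t)) / 2)))"
      by (simp only: power_mult_distrib norm_one_minus_cis_sq) (simp add: power2_eq_square)
    \<comment> \<open>Of the two factors \<open>riesz L j t\<close> in the square, one is bounded by
      1; the other is kept for the telescoping.\<close>
    also have "\<dots> \<le> 1 * (riesz L j t * (4 * (1 - (1 + cos (L ^ j * t)) / 2)))"
      using half_one_plus_cos(2)[of "L ^ j * t"]
      by (intro mult_right_mono riesz_le_1 mult_nonneg_nonneg riesz_nonneg) simp_all
    also have "\<dots> = 4 * (riesz L j t - riesz L (Suc j) t)"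
      by (simp add: riesz_Suc algebra_simps)
    finally show ?thesis .
  qed
  have "(\<Sum>j<N. (?a j)\<^sup>2) \<le> (\<Sum>j<N. 4 * (riesz L j t - riesz L (Suc j) t))"
    by (intro sum_mono sq)
  also have "\<dots> = 4 * (1 - riesz L N t)"
    using sum_lessThan_telescope'[of "\<lambda>j. riesz L j t" N] by (simp only: sum_distrib_left[symmetric] riesz_0)
  also have "\<dots> \<le> 4" using riesz_nonneg[of L N t] by simp
  finally have s4: "(\<Sum>j<N. (?a j)\<^sup>2) \<le> 4" .
  have "(\<Sum>j<N. ?a j)\<^sup>2 \<le> (\<Sum>j<N. (?a j)\<^sup>2) * card {..<N}"
    by (rule sum_squared_le_sum_of_squares)
  also have "\<dots> \<le> 4 * real N"
    using s4 by (simp add: mult_right_mono)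
  finally have "(\<Sum>j<N. ?a j) \<le> sqrt (4 * real N)"
    by (rule real_le_rsqrt)
  then show ?thesis by (simp add: real_sqrt_mult)
qed

text \<open>These are bounds of Bernstein type, with \<open>\<Sum>i<j. L ^ i\<close> as the highest
  frequency; they follow from the product rule by induction. The slope at 0 vanishes because every
  factor is even, which later makes the mixed derivative at the origin exact.\<close>

lemma riesz_derivatives:
  assumes "L \<ge> 0"
  shows "\<exists>A1 A2. (\<forall>t. (riesz L j has_real_derivative A1 t) (at t) \<and>
      (A1 has_real_derivative A2 t) (at t) \<and>
      \<bar>A1 t\<bar> \<le> (\<Sum>i<j. L ^ i) \<and> \<bar>A2 t\<bar> \<le> (\<Sum>i<j. L ^ i)\<^sup>2) \<and> A1 0 = 0"
proof (induction j)
  case 0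
  have "riesz L 0 = (\<lambda>t. 1)" by (rule ext) simp
  then show ?case
    by (intro exI[of _ "\<lambda>_. 0"]) simp
next
  case (Suc j)
  define S where "S = (\<Sum>i<j. L ^ i)"
  define M where "M = L ^ j"
  have S0: "S \<ge> 0" and M0: "M \<ge> 0"
    using assms by (auto simp: S_def M_def intro: sum_nonneg)
  from Suc obtain A1 A2 where A:
    "\<And>t. (riesz L j has_real_derivative A1 t) (at t)"
    "\<And>t. (A1 has_real_derivative A2 t) (at t)"
    "\<And>t. \<bar>A1 t\<bar> \<le> S" "\<And>t. \<bar>A2 t\<bar> \<le> S\<^sup>2" "A1 0 = 0"
    unfolding S_def by blast
  define r r1 r2 where "r = (\<lambda>t. (1 + cos (M * t)) / 2)"
    and "r1 = (\<lambda>t. - (M * sin (M * t) / 2))"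
    and "r2 = (\<lambda>t. - (M * M * cos (M * t) / 2))"
  have r: "(r has_real_derivative r1 t) (at t)" "(r1 has_real_derivative r2 t) (at t)" for t
    unfolding r_def r1_def r2_def by (auto intro!: derivative_eq_intros)
  have br: "\<bar>r t\<bar> \<le> 1" "\<bar>r1 t\<bar> \<le> M / 2" "\<bar>r2 t\<bar> \<le> M * M / 2" for t
  proof -
    show "\<bar>r t\<bar> \<le> 1"
      using half_one_plus_cos[of "M * t"] by (simp add: r_def)
    have "M * \<bar>sin (M * t)\<bar> \<le> M * 1" "M * M * \<bar>cos (M * t)\<bar> \<le> M * M * 1"
      using M0 by (intro mult_left_mono; simp)+
    then show "\<bar>r1 t\<bar> \<le> M / 2" "\<bar>r2 t\<bar> \<le> M * M / 2"
      using M0 by (simp_all add: r1_def r2_def abs_mult)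
  qed
  have bA: "\<bar>riesz L j t\<bar> \<le> 1" for t
    using riesz_nonneg[of L j t] riesz_le_1[of L j t] by simp
  let ?B1 = "\<lambda>t. A1 t * r t + riesz L j t * r1 t"
  let ?B2 = "\<lambda>t. A2 t * r t + 2 * (A1 t * r1 t) + riesz L j t * r2 t"
  have eq: "riesz L (Suc j) = (\<lambda>t. riesz L j t * r t)"
    by (rule ext) (simp add: riesz_Suc r_def M_def)
  have "(riesz L (Suc j) has_real_derivative ?B1 t) (at t)" for t
    unfolding eq by (auto intro!: derivative_eq_intros A r)
  moreover have "(?B1 has_real_derivative ?B2 t) (at t)" for t
    by (auto intro!: derivative_eq_intros A r)
  moreover have "\<bar>?B1 t\<bar> \<le> S + M" for t
  proof -
    have "\<bar>A1 t * r t\<bar> \<le> S * 1" "\<bar>riesz L j t * r1 t\<bar> \<le> 1 * (M / 2)"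
      unfolding abs_mult using A br bA S0 by (intro mult_mono; auto)+
    then show ?thesis using M0 abs_triangle_ineq[of "A1 t * r t" "riesz L j t * r1 t"] by simp
  qed
  moreover have "\<bar>?B2 t\<bar> \<le> (S + M)\<^sup>2" for t
  proof -
    have "\<bar>A2 t * r t\<bar> \<le> S\<^sup>2 * 1" "\<bar>A1 t * r1 t\<bar> \<le> S * (M / 2)"
      "\<bar>riesz L j t * r2 t\<bar> \<le> 1 * (M * M / 2)"
      unfolding abs_mult using A br bA S0 by (intro mult_mono; auto)+
    moreover have "M * M / 2 \<le> M * M" "S * M \<le> 2 * (S * M)" using M0 S0 by simp_all
    ultimately have "\<bar>?B2 t\<bar> \<le> S\<^sup>2 + 2 * (S * M) + M * M" by linarith
    then show ?thesis by (simp add: power2_eq_square algebra_simps)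
  qed
  moreover have "?B1 0 = 0" using A(5) by (simp add: r1_def)
  ultimately show ?case
    unfolding sum.lessThan_Suc S_def[symmetric] M_def[symmetric]
    by (intro exI[of _ ?B1] exI[of _ ?B2]) simp
qed

subsection \<open>Functions with prescribed spectrum\<close>

text \<open>The coefficients stay existential because only the location of the frequencies matters.
  The set \<open>S\<close> is meant to be finite: over an infinite set the sum is \<open>0\<close>
  by convention.\<close>

definition spectrum_in1 :: "int set \<Rightarrow> (real \<Rightarrow> complex) \<Rightarrow> bool" where
  "spectrum_in1 S f \<longleftrightarrow> (\<exists>c. \<forall>t. f t = (\<Sum>k\<in>S. c k * cis (of_int k * t)))"

definition spectrum_in :: "(int \<times> int) set \<Rightarrow> (real \<times> real \<Rightarrow> complex) \<Rightarrow> bool" where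
  "spectrum_in S f \<longleftrightarrow>
     (\<exists>c. \<forall>x y. f (x, y) = (\<Sum>(k, l)\<in>S. c (k, l) * cis (of_int k * x + of_int l * y)))"

lemma spectrum_in1_mono:
  assumes "spectrum_in1 S f" "S \<subseteq> T" "finite T"
  shows "spectrum_in1 T f"
proof -
  from assms(1) obtain c where c: "\<And>t. f t = (\<Sum>k\<in>S. c k * cis (of_int k * t))"
    unfolding spectrum_in1_def by blast
  have "f t = (\<Sum>k\<in>T. (if k \<in> S then c k else 0) * cis (of_int k * t))" for t
    unfolding c by (rule sum.mono_neutral_cong_left) (use assms in auto)
  then show ?thesis unfolding spectrum_in1_def
    by (intro exI[of _ "\<lambda>k. if k \<in> S then c k else 0"]) simp
qed

lemma spectrum_in1_add:
  assumes "spectrum_in1 S f" "spectrum_in1 S g"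
  shows "spectrum_in1 S (\<lambda>t. f t + g t)"
proof -
  from assms obtain c d where "\<And>t. f t = (\<Sum>k\<in>S. c k * cis (of_int k * t))"
    "\<And>t. g t = (\<Sum>k\<in>S. d k * cis (of_int k * t))"
    unfolding spectrum_in1_def by blast
  then have "f t + g t = (\<Sum>k\<in>S. (c k + d k) * cis (of_int k * t))" for t
    by (simp add: sum.distrib distrib_right)
  then show ?thesis unfolding spectrum_in1_def by (intro exI[of _ "\<lambda>k. c k + d k"]) simp
qed

lemma spectrum_in1_cmult:
  assumes "spectrum_in1 S f"
  shows "spectrum_in1 S (\<lambda>t. a * f t)"
proof -
  from assms obtain c where "\<And>t. f t = (\<Sum>k\<in>S. c k * cis (of_int k * t))"
    unfolding spectrum_in1_def by blast
  then show ?thesis unfolding spectrum_in1_def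
    by (intro exI[of _ "\<lambda>k. a * c k"]) (simp add: sum_distrib_left mult.assoc)
qed

lemma spectrum_in1_mult_cis:
  assumes "spectrum_in1 {a..b} f"
  shows "spectrum_in1 {a + m..b + m} (\<lambda>t. f t * cis (of_int m * t))"
proof -
  from assms obtain c where c: "\<And>t. f t = (\<Sum>k\<in>{a..b}. c k * cis (of_int k * t))"
    unfolding spectrum_in1_def by blast
  have "f t * cis (of_int m * t) = (\<Sum>k\<in>{a + m..b + m}. c (k - m) * cis (of_int k * t))" for t
    unfolding c sum_distrib_right
    by (rule sum.reindex_bij_witness[of _ "\<lambda>k. k - m" "\<lambda>k. k + m"])
       (auto simp: cis_mult distrib_right mult.assoc)
  then show ?thesis unfolding spectrum_in1_def
    by (intro exI[of _ "\<lambda>k. c (k - m)"]) simp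
qed

lemma spectrum_in_mono:
  assumes "spectrum_in S f" "S \<subseteq> T" "finite T"
  shows "spectrum_in T f"
proof -
  from assms(1) obtain c where
    c: "\<And>x y. f (x, y) = (\<Sum>(k, l)\<in>S. c (k, l) * cis (of_int k * x + of_int l * y))"
    unfolding spectrum_in_def by blast
  have "f (x, y) = (\<Sum>(k, l)\<in>T. (if (k, l) \<in> S then c (k, l) else 0)
           * cis (of_int k * x + of_int l * y))" for x y
    unfolding c by (rule sum.mono_neutral_cong_left) (use assms in auto)
  then show ?thesis unfolding spectrum_in_def
    by (intro exI[of _ "\<lambda>p. if p \<in> S then c p else 0"]) simp
qed

lemma spectrum_in_add:
  assumes "spectrum_in S f" "spectrum_in S g"
  shows "spectrum_in S (\<lambda>p. f p + g p)"
proof -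
  from assms obtain c d where
    "\<And>x y. f (x, y) = (\<Sum>(k, l)\<in>S. c (k, l) * cis (of_int k * x + of_int l * y))"
    "\<And>x y. g (x, y) = (\<Sum>(k, l)\<in>S. d (k, l) * cis (of_int k * x + of_int l * y))"
    unfolding spectrum_in_def by blast
  then show ?thesis unfolding spectrum_in_def
    by (intro exI[of _ "\<lambda>p. c p + d p"])
       (simp add: sum.distrib[symmetric] distrib_right split_def)
qed

lemma spectrum_in_cmult:
  assumes "spectrum_in S f"
  shows "spectrum_in S (\<lambda>p. a * f p)"
proof -
  from assms obtain c where
    "\<And>x y. f (x, y) = (\<Sum>(k, l)\<in>S. c (k, l) * cis (of_int k * x + of_int l * y))"
    unfolding spectrum_in_def by blast
  then show ?thesis unfolding spectrum_in_def
    by (intro exI[of _ "\<lambda>p. a * c p"]) (simp add: sum_distrib_left mult.assoc split_def)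
qed

lemma spectrum_in_sum:
  assumes "\<And>i. i \<in> I \<Longrightarrow> spectrum_in S (f i)"
  shows "spectrum_in S (\<lambda>p. \<Sum>i\<in>I. f i p)"
proof -
  have zero: "spectrum_in S (\<lambda>p. 0)"
    unfolding spectrum_in_def by (intro exI[of _ "\<lambda>_. 0"]) (simp add: split_def)
  show ?thesis
  proof (cases "finite I")
    case True
    then show ?thesis using assms
      by (induction I) (simp_all add: zero spectrum_in_add)
  next
    case False
    then show ?thesis using zero by simp
  qed
qed

lemma spectrum_in_tensor:
  assumes "spectrum_in1 S f" "spectrum_in1 T g"
  shows "spectrum_in (S \<times> T) (\<lambda>(x, y). f x * g y)"
proof -
  from assms obtain c d where "\<And>t. f t = (\<Sum>k\<in>S. c k * cis (of_int k * t))"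
    "\<And>t. g t = (\<Sum>k\<in>T. d k * cis (of_int k * t))"
    unfolding spectrum_in1_def by blast
  then have "f x * g y =
      (\<Sum>(k, l)\<in>S \<times> T. (c k * d l) * cis (of_int k * x + of_int l * y))" for x y
    by (simp add: sum_product sum.cartesian_product cis_mult[symmetric] mult_ac)
  then show ?thesis unfolding spectrum_in_def
    by (intro exI[of _ "\<lambda>(k, l). c k * d l"]) simp
qed

text \<open>By Euler's formula the new factor is
  \<open>1/2 + 1/4 * cis (M * t) + 1/4 * cis (- M * t)\<close> with \<open>M = L ^ j\<close>, so
  each step widens the frequency interval by \<open>M\<close> on both sides.\<close>

lemma spectrum_in1_riesz:
  "spectrum_in1 {- int (\<Sum>i<j. L ^ i)..int (\<Sum>i<j. L ^ i)} (\<lambda>t. of_real (riesz (real L) j t))"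
proof (induction j)
  case 0
  show ?case unfolding spectrum_in1_def by (intro exI[of _ "\<lambda>_. 1"]) simp
next
  case (Suc j)
  define S where "S = int (\<Sum>i<j. L ^ i)"
  define M where "M = int (L ^ j)"
  have M0: "M \<ge> 0" by (simp add: M_def)
  let ?f = "\<lambda>t. complex_of_real (riesz (real L) j t)"
  have f: "spectrum_in1 {-S..S} ?f" using Suc by (simp add: S_def)
  let ?T = "{-(S + M)..S + M}"
  have "spectrum_in1 ?T ?f"
    by (rule spectrum_in1_mono[OF f]) (use M0 in auto)
  moreover have "spectrum_in1 ?T (\<lambda>t. ?f t * cis (of_int M * t))"
    by (rule spectrum_in1_mono[OF spectrum_in1_mult_cis[OF f]]) (use M0 in auto)
  moreover have "spectrum_in1 ?T (\<lambda>t. ?f t * cis (of_int (- M) * t))"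
    by (rule spectrum_in1_mono[OF spectrum_in1_mult_cis[OF f]]) (use M0 in auto)
  ultimately have "spectrum_in1 ?T (\<lambda>t. (1/2) * ?f t + ((1/4) * (?f t * cis (of_int M * t))
       + (1/4) * (?f t * cis (of_int (- M) * t))))"
    by (intro spectrum_in1_add spectrum_in1_cmult)
  moreover have "(\<lambda>t. (1/2) * ?f t + ((1/4) * (?f t * cis (of_int M * t))
       + (1/4) * (?f t * cis (of_int (- M) * t)))) = (\<lambda>t. of_real (riesz (real L) (Suc j) t))"
    by (rule ext) (simp add: riesz_Suc M_def complex_eq_iff algebra_simps)
  ultimately show ?case by (simp add: S_def M_def)
qed

lemma finite_int_triangle: "finite {(k, l). 1 \<le> k \<and> 1 \<le> l \<and> k + l \<le> (n :: int)}"
  by (rule finite_subset[of _ "{1..n} \<times> {1..n}"]) auto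

lemma trig_fun_cis:
  "trig_fun P (x, y) = (\<Sum>(k, l)\<in>Poly_Mapping.keys P.
     Poly_Mapping.lookup P (k, l) * cis (of_int k * x + of_int l * y))"
  by (simp add: trig_fun_def cis_conv_exp)

text \<open>The frequency \<open>(n, 0)\<close> lies outside the triangle, where
  \<open>1 \<le> l\<close>, so the extra monomial cannot cancel against a term of \<open>f\<close>.
  It brings the degree up to \<open>n\<close> however small \<open>e\<close> is, and the triangle
  keeps the degree from exceeding \<open>n\<close>.\<close>

lemma trig_poly_of_spectrum:
  assumes f: "spectrum_in {(k, l). 1 \<le> k \<and> 1 \<le> l \<and> k + l \<le> int n} f" and e: "e \<noteq> 0"
  obtains P where "analytic_trig_poly P" "trig_degree P = n"
    "\<forall>x y. trig_fun P (x, y) = f (x, y) + e * cis (real n * x)"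
proof -
  let ?S = "{(k, l). 1 \<le> k \<and> 1 \<le> l \<and> k + l \<le> int n}"
  let ?T = "insert (int n, 0) ?S"
  from f obtain c where
    c: "\<And>x y. f (x, y) = (\<Sum>(k, l)\<in>?S. c (k, l) * cis (of_int k * x + of_int l * y))"
    unfolding spectrum_in_def by blast
  define d where "d = (\<lambda>p. if p = (int n, 0) then e else if p \<in> ?S then c p else 0)"
  define P where "P = Poly_Mapping.Abs_poly_mapping d"
  have finT: "finite ?T" using finite_int_triangle by simp
  have "finite {p. d p \<noteq> 0}"
    by (rule finite_subset[OF _ finT]) (auto simp: d_def)
  then have lookup: "Poly_Mapping.lookup P = d"
    unfolding P_def by (simp add: lookup_Abs_poly_mapping)
  have keys: "Poly_Mapping.keys P \<subseteq> ?T"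
    by (auto simp: in_keys_iff lookup d_def split: if_splits)
  have key: "(int n, 0) \<in> Poly_Mapping.keys P"
    using e by (simp add: in_keys_iff lookup d_def)
  show ?thesis
  proof
    show "analytic_trig_poly P"
      by (auto simp: analytic_trig_poly_def lookup d_def)
    have "Max (insert 0 ((\<lambda>(k1, k2). k1 + k2) ` Poly_Mapping.keys P)) = int n"
    proof (rule Max_eqI)
      show "int n \<in> insert 0 ((\<lambda>(k1, k2). k1 + k2) ` Poly_Mapping.keys P)"
        using key by (auto intro!: rev_image_eqI)
    qed (use keys in auto)
    then show "trig_degree P = n" by (simp add: trig_degree_def)
    show "\<forall>x y. trig_fun P (x, y) = f (x, y) + e * cis (real n * x)"
    proof (intro allI)
      fix x y
      have "trig_fun P (x, y) = (\<Sum>(k, l)\<in>?T. d (k, l) * cis (of_int k * x + of_int l * y))"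
        unfolding trig_fun_cis lookup
        by (rule sum.mono_neutral_left[OF finT keys]) (auto simp: in_keys_iff lookup)
      also have "\<dots> = e * cis (real n * x)
          + (\<Sum>(k, l)\<in>?S. d (k, l) * cis (of_int k * x + of_int l * y))"
        by (subst sum.insert) (use finite_int_triangle in \<open>auto simp: d_def\<close>)
      also have "(\<Sum>(k, l)\<in>?S. d (k, l) * cis (of_int k * x + of_int l * y)) = f (x, y)"
        unfolding c by (rule sum.cong) (auto simp: d_def)
      finally show "trig_fun P (x, y) = f (x, y) + e * cis (real n * x)" by simp
    qed
  qed
qed

subsection \<open>Partial derivatives and suprema\<close>

text \<open>\<open>vector_derivative\<close> is meaningful only where a derivative exists. The
  relational form carries existence along, so iterated derivatives can be computed first and
  identified with \<open>partial_x\<close> afterwards.\<close>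

definition has_partial_x where
  "has_partial_x f g \<longleftrightarrow> (\<forall>x y. ((\<lambda>t. f (t, y)) has_vector_derivative g (x, y)) (at x))"
  for f g :: "real \<times> real \<Rightarrow> complex"

definition has_partial_y where
  "has_partial_y f g \<longleftrightarrow> (\<forall>x y. ((\<lambda>t. f (x, t)) has_vector_derivative g (x, y)) (at y))"
  for f g :: "real \<times> real \<Rightarrow> complex"

lemma partial_x_eq: "has_partial_x f g \<Longrightarrow> partial_x f = g"
  by (auto simp: partial_x_def has_partial_x_def intro!: vector_derivative_at)

lemma partial_y_eq: "has_partial_y f g \<Longrightarrow> partial_y f = g"
  by (auto simp: partial_y_def has_partial_y_def intro!: vector_derivative_at)

lemma sup_norm_le:
  assumes "\<And>x y. norm (f (x, y)) \<le> B"
  shows "sup_norm f \<le> B"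
  unfolding sup_norm_def by (rule cSUP_least) (use assms in auto)

text \<open>The bound \<open>B\<close> certifies that the real-valued supremum is taken over a set
  bounded above.\<close>

lemma sup_norm_ge:
  assumes "\<And>x y. norm (f (x, y)) \<le> B"
  shows "norm (f p) \<le> sup_norm f"
  unfolding sup_norm_def
proof (rule cSUP_upper)
  show "bdd_above (range (\<lambda>p. norm (f p)))"
    by (rule bdd_aboveI[of _ B]) (use assms in auto)
qed simp

text \<open>The shape \<open>a * f p + g p\<close> is that of the final polynomial: a rescaled Riesz
  sum plus a monomial.\<close>

lemma has_partial_x_add_cmult:
  assumes "has_partial_x f f'" "has_partial_x g g'"
  shows "has_partial_x (\<lambda>p. a * f p + g p) (\<lambda>p. a * f' p + g' p)"
  using assms unfolding has_partial_x_def by (auto intro!: derivative_eq_intros)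

lemma has_partial_y_add_cmult:
  assumes "has_partial_y f f'" "has_partial_y g g'"
  shows "has_partial_y (\<lambda>p. a * f p + g p) (\<lambda>p. a * f' p + g' p)"
  using assms unfolding has_partial_y_def by (auto intro!: derivative_eq_intros)

lemma has_vector_derivative_cis:
  "((\<lambda>t. cis (a * t)) has_vector_derivative \<i> * of_real a * cis (a * t)) (at t)"
proof -
  have "((\<lambda>t. cis (a * t)) has_vector_derivative a *\<^sub>R (\<i> * cis (a * t))) (at t)"
    unfolding has_vector_derivative_def
    by (rule has_derivative_eq_rhs, rule has_derivative_cis)
       (auto intro!: derivative_eq_intros simp: scaleR_conv_of_real)
  then show ?thesis by (simp add: scaleR_conv_of_real mult_ac)
qed

subsection \<open>Modulated Riesz products\<close>

text \<open>The Riesz product factors over the coordinates, so each localised character is a bump in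
  \<open>x\<close> times a bump in \<open>y\<close>, with \<open>a\<close> equal to 1 or 2.\<close>

definition bump :: "real \<Rightarrow> real \<Rightarrow> nat \<Rightarrow> real \<Rightarrow> complex" where
  "bump L a j t = of_real (riesz L j t) * cis (a * L ^ j * t)"

text \<open>This is the source of every \<open>1 / L\<close> error: the frequencies of
  \<open>riesz L j\<close> are below \<open>L ^ j\<close> by a factor of order
  \<open>L\<close>.\<close>

lemma geometric_sum_le:
  assumes "L \<ge> (2 :: real)"
  shows "(\<Sum>i<j. L ^ i) * L \<le> 2 * L ^ j"
proof (induction j)
  case (Suc j)
  have "2 * L ^ j \<le> L * L ^ j" using assms by (intro mult_right_mono) auto
  then show ?case using Suc by (simp add: algebra_simps)
qed simp

lemma norm_bump: "norm (bump L a j t) = riesz L j t"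
  by (simp add: bump_def norm_mult riesz_nonneg)

text \<open>With \<open>M = L ^ j\<close>, a derivative falling on the character costs
  \<open>a * M\<close>, one falling on the Riesz factor only about \<open>M / L\<close>. After
  division by \<open>M\<^sup>2\<close> the bump is thus almost an eigenfunction of the second
  derivative, with eigenvalue \<open>- a\<^sup>2\<close>. The crude bound on \<open>B1\<close>
  serves to show that the mixed derivative is bounded.\<close>

lemma bump_derivatives:
  assumes L: "L \<ge> 2" and a: "0 \<le> a" "a \<le> 2"
  shows "\<exists>B1 B2. (\<forall>t. (bump L a j has_vector_derivative B1 t) (at t) \<and>
      (B1 has_vector_derivative B2 t) (at t) \<and> norm (B1 t) \<le> 3 * L ^ j \<and>
      norm (B2 t / (of_real (L ^ j))\<^sup>2 + of_real (a\<^sup>2) * bump L a j t) \<le> 10 / L) \<and>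
      B1 0 = \<i> * of_real (a * L ^ j)"
proof -
  define S where "S = (\<Sum>i<j. L ^ i)"
  define M where "M = L ^ j"
  have M0: "M > 0" and S0: "S \<ge> 0"
    using L by (auto simp: M_def S_def intro: sum_nonneg)
  have SL: "S * L \<le> 2 * M"
    using geometric_sum_le[OF L] by (simp add: S_def M_def)
  have "S * 2 \<le> S * L" using L S0 by (intro mult_left_mono) auto
  then have SM: "S \<le> M" using SL by simp
  from riesz_derivatives[of L j] L obtain A1 A2 where A:
    "\<And>t. (riesz L j has_real_derivative A1 t) (at t)"
    "\<And>t. (A1 has_real_derivative A2 t) (at t)"
    "\<And>t. \<bar>A1 t\<bar> \<le> S" "\<And>t. \<bar>A2 t\<bar> \<le> S\<^sup>2" "A1 0 = 0"
    unfolding S_def by force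
  let ?A = "riesz L j"
  define B1 where "B1 = (\<lambda>t. (of_real (A1 t) + \<i> * of_real (a * M) * of_real (?A t)) * cis (a * M * t))"
  define B2 where "B2 = (\<lambda>t. (of_real (A2 t) + 2 * \<i> * of_real (a * M) * of_real (A1 t)
      - of_real ((a * M)\<^sup>2) * of_real (?A t)) * cis (a * M * t))"
  have dA: "((\<lambda>t. complex_of_real (?A t)) has_vector_derivative of_real (A1 t)) (at t)"
       "((\<lambda>t. complex_of_real (A1 t)) has_vector_derivative of_real (A2 t)) (at t)" for t
    using A(1,2)[of t]
    by (auto intro!: has_vector_derivative_of_real simp: has_real_derivative_iff_has_vector_derivative)
  have bump_eq: "bump L a j = (\<lambda>t. of_real (?A t) * cis (a * M * t))"
    by (rule ext) (simp add: bump_def M_def)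
  have "(bump L a j has_vector_derivative B1 t) (at t)" for t
    unfolding B1_def bump_eq
    by (rule has_vector_derivative_eq_rhs[OF has_vector_derivative_mult[OF dA(1) has_vector_derivative_cis]])
       (simp add: algebra_simps)
  moreover have "(B1 has_vector_derivative B2 t) (at t)" for t
    unfolding B1_def B2_def
    by (rule has_vector_derivative_eq_rhs[OF has_vector_derivative_mult[OF
          has_vector_derivative_add[OF dA(2) has_vector_derivative_mult_right[OF dA(1)]]
          has_vector_derivative_cis]])
       (simp add: algebra_simps power2_eq_square)
  moreover have "norm (B1 t) \<le> 3 * M" for t
  proof -
    have "norm (B1 t) \<le> \<bar>A1 t\<bar> + a * M * ?A t"
      unfolding B1_def norm_mult norm_cis
      using norm_triangle_ineq[of "of_real (A1 t)" "\<i> * of_real (a * M) * of_real (?A t)"] a M0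
      by (simp add: norm_mult riesz_nonneg)
    also have "a * M * ?A t \<le> 2 * M * 1"
      using a M0 by (intro mult_mono riesz_le_1 riesz_nonneg) auto
    finally show ?thesis using A(3)[of t] SM by simp
  qed
  moreover have "norm (B2 t / (of_real M)\<^sup>2 + of_real (a\<^sup>2) * bump L a j t) \<le> 10 / L" for t
  proof -
    have "B2 t / (of_real M)\<^sup>2 + of_real (a\<^sup>2) * bump L a j t
        = ((of_real (A2 t) + 2 * \<i> * of_real (a * M) * of_real (A1 t)) / of_real (M\<^sup>2)) * cis (a * M * t)"
      using M0 by (simp add: B2_def bump_def M_def[symmetric] field_simps power2_eq_square)
    also have "norm \<dots> = norm (of_real (A2 t) + 2 * \<i> * of_real (a * M) * of_real (A1 t)) / M\<^sup>2"
      by (simp add: norm_mult norm_divide norm_power)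
    also have "norm (of_real (A2 t) + 2 * \<i> * of_real (a * M) * of_real (A1 t))
        \<le> \<bar>A2 t\<bar> + 2 * (a * M) * \<bar>A1 t\<bar>"
      by (rule order.trans[OF norm_triangle_ineq]) (use a M0 in \<open>simp add: norm_mult\<close>)
    \<comment> \<open>One factor of \<open>S\<^sup>2\<close> is relaxed to \<open>M\<close>, so both
      terms become multiples of \<open>S * M\<close>, five in total; then
      \<open>S * L \<le> 2 * M\<close> gives \<open>10 / L\<close>.\<close>
    also have "\<dots> \<le> S * M + 2 * (2 * M) * S"
    proof -
      have "\<bar>A2 t\<bar> \<le> S * M"
        using A(4)[of t] mult_left_mono[OF SM S0] by (simp add: power2_eq_square)
      moreover have "2 * (a * M) * \<bar>A1 t\<bar> \<le> 2 * (2 * M) * S"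
        using a M0 A(3) by (intro mult_mono) auto
      ultimately show ?thesis by linarith
    qed
    also have "\<dots> / M\<^sup>2 = 5 * S / M"
      using M0 by (simp add: field_simps power2_eq_square)
    also have "\<dots> \<le> 10 / L"
      using SL M0 L by (simp add: field_simps)
    finally show ?thesis using M0 by (simp add: divide_right_mono)
  qed
  moreover have "B1 0 = \<i> * of_real (a * M)"
    using A(5) by (simp add: B1_def)
  ultimately show ?thesis
    unfolding M_def by blast
qed

text \<open>The Riesz factor has frequencies strictly below \<open>L ^ j\<close> in absolute value,
  so the shift by \<open>a * L ^ j\<close> makes all of them positive. This is what yields
  analyticity.\<close>

lemma spectrum_in1_bump:
  assumes L: "L \<ge> (2::nat)" and a: "1 \<le> a" "a \<le> 2"
  shows "spectrum_in1 {1..3 * int (L ^ j)} (bump (real L) (real a) j)"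
proof -
  define S where "S = (\<Sum>i<j. L ^ i)"
  have "S < L ^ j"
    unfolding S_def
  proof (induction j)
    case (Suc j)
    have "2 * L ^ j \<le> L * L ^ j" using L by (intro mult_right_mono) auto
    then have "2 * L ^ j \<le> L ^ Suc j" by simp
    then show ?case using Suc unfolding sum.lessThan_Suc by linarith
  qed simp
  define M where "M = int (L ^ j)"
  have SM: "int S < M"
    unfolding M_def using \<open>S < L ^ j\<close> by (simp only: of_nat_less_iff)
  define K where "K = int a * M"
  have "1 * M \<le> K" "K \<le> 2 * M"
    unfolding K_def using a SM by (intro mult_right_mono; simp)+
  have "spectrum_in1 {- int S + int (a * L ^ j)..int S + int (a * L ^ j)}
      (\<lambda>t. of_real (riesz (real L) j t) * cis (of_int (int (a * L ^ j)) * t))"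
    unfolding S_def by (rule spectrum_in1_mult_cis[OF spectrum_in1_riesz])
  then have "spectrum_in1 {- int S + K..int S + K} (bump (real L) (real a) j)"
    unfolding bump_def by (simp add: M_def K_def)
  then show ?thesis
    unfolding M_def[symmetric] by (rule spectrum_in1_mono) (use SM \<open>1 * M \<le> K\<close> \<open>K \<le> 2 * M\<close> in auto)
qed

subsection \<open>The extremal polynomials\<close>

lemma has_partial_x_tensor_sum:
  assumes "\<And>i t. i \<in> I \<Longrightarrow> (u i has_vector_derivative u' i t) (at t)"
    and "\<And>i t. i \<in> I \<Longrightarrow> (v i has_vector_derivative v' i t) (at t)"
  shows "has_partial_x
    (\<lambda>(x, y). \<Sum>i\<in>I. (u i x * f i y + v i x * g i y - 5 * (u i x * h i y)) / c i)
    (\<lambda>(x, y). \<Sum>i\<in>I. (u' i x * f i y + v' i x * g i y - 5 * (u' i x * h i y)) / c i)"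
  unfolding has_partial_x_def case_prod_conv
  by (intro allI has_vector_derivative_sum has_vector_derivative_divide
       has_vector_derivative_add has_vector_derivative_diff has_vector_derivative_mult_left
       has_vector_derivative_mult_right assms)

text \<open>\<open>Q\<close> is the sum over scales of bump products, with coefficients 1, 1, -5.
  Main terms contribute \<open>10 * sqrt N\<close> to each pure derivative; the errors are
  \<open>N\<close> times \<open>70 / L\<close>, hence at most 70 by \<open>N \<le> L\<close>. Each
  scale contributes exactly 1 to the mixed derivative at the origin.\<close>

lemma riesz_sum_derivatives:
  assumes L: "L \<ge> (2::nat)" and NL: "N \<le> L" and N: "N \<ge> 1"
  obtains Q Qx Qxx Qy Qyy Qxy B where
    "spectrum_in ({1..3 * int (L ^ (N - 1))} \<times> {1..3 * int (L ^ (N - 1))}) Q"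
    "has_partial_x Q Qx" "has_partial_x Qx Qxx" "has_partial_y Q Qy" "has_partial_y Qy Qyy"
    "has_partial_x Qy Qxy"
    "\<forall>x y. norm (Qxx (x, y)) \<le> 80 * sqrt N" "\<forall>x y. norm (Qyy (x, y)) \<le> 80 * sqrt N"
    "\<forall>x y. norm (Qxy (x, y)) \<le> B" "Qxy (0, 0) = of_nat N"
proof -
  define u where "u = bump (real L) 1"
  define v where "v = bump (real L) 2"
  define M where "M = (\<lambda>j. real (L ^ j))"
  define c where "c = (\<lambda>j. (complex_of_real (M j))\<^sup>2)"
  have M0: "M j > 0" for j using L by (simp add: M_def)
  have L2: "real L \<ge> 2" using L by simp
  have "\<forall>j. \<exists>B1 B2. (\<forall>t. (u j has_vector_derivative B1 t) (at t) \<and>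
      (B1 has_vector_derivative B2 t) (at t) \<and> norm (B1 t) \<le> 3 * M j \<and>
      norm (B2 t / c j + u j t) \<le> 10 / L) \<and>
      B1 0 = \<i> * of_real (M j)"
    using bump_derivatives[OF L2, of 1] by (simp add: u_def M_def c_def)
  then obtain u1 u2 where u:
    "\<And>j t. (u j has_vector_derivative u1 j t) (at t)"
    "\<And>j t. (u1 j has_vector_derivative u2 j t) (at t)"
    "\<And>j t. norm (u1 j t) \<le> 3 * M j"
    "\<And>j t. norm (u2 j t / c j + u j t) \<le> 10 / L"
    "\<And>j. u1 j 0 = \<i> * of_real (M j)"
    by metis
  have "\<forall>j. \<exists>B1 B2. (\<forall>t. (v j has_vector_derivative B1 t) (at t) \<and>
      (B1 has_vector_derivative B2 t) (at t) \<and> norm (B1 t) \<le> 3 * M j \<and>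
      norm (B2 t / c j + 4 * v j t) \<le> 10 / L) \<and>
      B1 0 = \<i> * of_real (2 * M j)"
    using bump_derivatives[OF L2, of 2] by (simp add: v_def M_def c_def)
  then obtain v1 v2 where v:
    "\<And>j t. (v j has_vector_derivative v1 j t) (at t)"
    "\<And>j t. (v1 j has_vector_derivative v2 j t) (at t)"
    "\<And>j t. norm (v1 j t) \<le> 3 * M j"
    "\<And>j t. norm (v2 j t / c j + 4 * v j t) \<le> 10 / L"
    "\<And>j. v1 j 0 = \<i> * of_real (2 * M j)"
    by metis
  \<comment> \<open>\<open>Q\<close> and all its derivatives have this one shape: differentiating in
    \<open>x\<close> changes only \<open>f\<close> and \<open>g\<close>, in \<open>y\<close> only
    \<open>h\<close> and \<open>k\<close>. Exchanging the variables exchanges the two pairs, so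
    everything about \<open>y\<close> follows from \<open>x\<close>.\<close>
  define T where "T = (\<lambda>(f :: nat \<Rightarrow> real \<Rightarrow> complex) g h k (x :: real, y :: real).
      \<Sum>j<N. (f j x * k j y + g j x * h j y - 5 * (f j x * h j y)) / c j)"
  have Tx: "has_partial_x (T f g h k) (T f' g' h k)"
    if "\<And>j t. (f j has_vector_derivative f' j t) (at t)"
       "\<And>j t. (g j has_vector_derivative g' j t) (at t)" for f g h k f' g'
    unfolding T_def by (rule has_partial_x_tensor_sum) (use that in auto)
  have sym: "T f g h k (x, y) = T h k f g (y, x)" for f g h k x y
    by (simp add: T_def algebra_simps)
  have Ty: "has_partial_y (T f g h k) (T f g h' k')"
    if "\<And>j t. (h j has_vector_derivative h' j t) (at t)"
       "\<And>j t. (k j has_vector_derivative k' j t) (at t)" for f g h k h' k'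
  proof -
    have "has_partial_x (T h k f g) (T h' k' f g)"
      by (rule Tx) (use that in auto)
    then show ?thesis
      unfolding has_partial_x_def has_partial_y_def by (simp add: sym[of f g])
  qed
  have nu: "norm (u j t) \<le> 1" and nv: "norm (v j t) \<le> 1" for j t
    by (simp_all add: u_def v_def norm_bump riesz_le_1)
  have vu: "norm (v j t - u j t) = riesz L j t * norm (1 - cis (M j * t))" for j t
  proof -
    have "v j t - u j t = - (u j t * (1 - cis (M j * t)))"
      by (simp add: u_def v_def bump_def M_def cis_mult algebra_simps)
    then have "norm (v j t - u j t) = norm (u j t) * norm (1 - cis (M j * t))"
      by (simp only: norm_minus_cancel norm_mult)
    then show ?thesis by (simp add: u_def norm_bump)
  qed
  have xx: "norm (T u2 v2 u v (x, y)) \<le> 80 * sqrt N" for x y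
  proof -
    let ?d = "\<lambda>j t. riesz L j t * norm (1 - cis (real L ^ j * t))"
    \<comment> \<open>Here \<open>r\<close> and \<open>s\<close> are the deviations from the
      eigenfunction relations, each at most \<open>10 / L\<close>. They enter with weights 1, 1 and
      5, which gives \<open>70 / L\<close>.\<close>
    have term_le: "norm ((u2 j x * v j y + v2 j x * u j y - 5 * (u2 j x * u j y)) / c j)
        \<le> ?d j y + 4 * ?d j x + 70 / L" for j
    proof -
      define r s where "r = u2 j x / c j + u j x" and "s = v2 j x / c j + 4 * v j x"
      have c0: "c j \<noteq> 0" using M0[of j] by (simp add: c_def)
      have rs: "norm r \<le> 10 / L" "norm s \<le> 10 / L"
        using u(4) v(4) by (simp_all add: r_def s_def)
      have "(u2 j x * v j y + v2 j x * u j y - 5 * (u2 j x * u j y)) / c j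
          = (r - u j x) * v j y + (s - 4 * v j x) * u j y - 5 * ((r - u j x) * u j y)"
        using c0 by (simp add: r_def s_def field_simps)
      \<comment> \<open>Because \<open>1 + 4 = 5\<close>, the main terms regroup into differences
        \<open>v j - u j\<close>, whose norms are exactly the summands controlled by the Riesz
        estimate.\<close>
      also have "\<dots> = - (u j x * (v j y - u j y)) + (- (4 * ((v j x - u j x) * u j y)))
          + (r * v j y + s * u j y + (- (5 * (r * u j y))))"
        by (simp add: algebra_simps)
      finally have eq: "(u2 j x * v j y + v2 j x * u j y - 5 * (u2 j x * u j y)) / c j = \<dots>" .
      have p: "norm (a * b) \<le> e" if "norm a \<le> e" "norm b \<le> 1" for a b :: complex and e
        using mult_mono[OF that] order.trans[OF norm_ge_zero that(1)] by (simp add: norm_mult)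
      have "norm (u j x * (v j y - u j y)) \<le> ?d j y"
        using p[of "v j y - u j y" "?d j y" "u j x"] nu vu[of j y] by (simp add: M_def mult.commute)
      moreover have "norm ((v j x - u j x) * u j y) \<le> ?d j x"
        by (rule p) (use nu vu[of j x] in \<open>simp_all add: M_def\<close>)
      moreover have "norm (r * v j y) \<le> 10 / L" "norm (s * u j y) \<le> 10 / L" "norm (r * u j y) \<le> 10 / L"
        by (intro p rs nu nv)+
      moreover have "norm (- a + (- (4 * b)) + (d + e + (- (5 * f)))) \<le>
          norm a + 4 * norm b + norm d + norm e + 5 * norm f" for a b d e f :: complex
        using norm_triangle_ineq[of "- a + - (4 * b)" "d + e + - (5 * f)"]
          norm_triangle_ineq[of "- a" "- (4 * b)"]
          norm_triangle_ineq[of "d + e" "- (5 * f)"] norm_triangle_ineq[of d e]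
        unfolding norm_minus_cancel by (simp add: norm_mult)
      note this[of "u j x * (v j y - u j y)" "(v j x - u j x) * u j y"
          "r * v j y" "s * u j y" "r * u j y"]
      moreover have "70 / real L = 7 * (10 / real L)" by simp
      ultimately show ?thesis
        unfolding eq by linarith
    qed
    have "norm (T u2 v2 u v (x, y)) \<le> (\<Sum>j<N. ?d j y + 4 * ?d j x + 70 / L)"
      unfolding T_def case_prod_conv by (rule sum_norm_le) (rule term_le)
    also have "\<dots> = (\<Sum>j<N. ?d j y) + 4 * (\<Sum>j<N. ?d j x) + N * (70 / L)"
      by (simp add: sum.distrib sum_distrib_left)
    also have "\<dots> \<le> 2 * sqrt N + 4 * (2 * sqrt N) + 70 * sqrt N"
    proof (intro add_mono mult_left_mono sum_riesz_norm_one_minus_cis_le)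
      have "N * (70 / L) \<le> 70 * 1" using NL L by (simp add: field_simps)
      also have "\<dots> \<le> 70 * sqrt N" using N by (intro mult_left_mono) auto
      finally show "N * (70 / L) \<le> 70 * sqrt N" .
    qed auto
    finally show ?thesis by simp
  qed
  define K where "K = 3 * int (L ^ (N - 1))"
  have spec: "spectrum_in ({1..K} \<times> {1..K}) (T u v u v)"
  proof -
    have S: "spectrum_in1 {1..K} (u j)" "spectrum_in1 {1..K} (v j)" if "j < N" for j
    proof -
      have "L ^ j \<le> L ^ (N - 1)" using that L by (intro power_increasing) auto
      then have le: "3 * int (L ^ j) \<le> K" unfolding K_def by (simp only: of_nat_le_iff)
      show "spectrum_in1 {1..K} (u j)" "spectrum_in1 {1..K} (v j)"
        using spectrum_in1_bump[OF L, of 1 j] spectrum_in1_bump[OF L, of 2 j] le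
        by (auto simp: u_def v_def intro: spectrum_in1_mono)
    qed
    have "spectrum_in ({1..K} \<times> {1..K}) (\<lambda>p. \<Sum>j<N.
        (1 / c j) * (\<lambda>(x, y). u j x * v j y) p + ((1 / c j) * (\<lambda>(x, y). v j x * u j y) p
        + (- 5 / c j) * (\<lambda>(x, y). u j x * u j y) p))"
      by (intro spectrum_in_sum spectrum_in_add spectrum_in_cmult spectrum_in_tensor S) auto
    also have "(\<lambda>p. \<Sum>j<N. (1 / c j) * (\<lambda>(x, y). u j x * v j y) p
        + ((1 / c j) * (\<lambda>(x, y). v j x * u j y) p
        + (- 5 / c j) * (\<lambda>(x, y). u j x * u j y) p)) = T u v u v"
      by (auto simp: T_def add_divide_distrib diff_divide_distrib intro!: sum.cong)
    finally show ?thesis .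
  qed
  \<comment> \<open>Any bound independent of \<open>x\<close> and \<open>y\<close> suffices here;
    its size is irrelevant.\<close>
  have xy_bound: "norm (T u1 v1 u1 v1 (x, y)) \<le>
      (\<Sum>j<N. (9 * M j ^ 2 + 9 * M j ^ 2 + 45 * M j ^ 2) / M j ^ 2)" for x y
    unfolding T_def case_prod_conv
  proof (rule sum_norm_le)
    fix j
    have p: "norm (a * b) \<le> 9 * M j ^ 2" if "norm a \<le> 3 * M j" "norm b \<le> 3 * M j" for a b :: complex
      using mult_mono[OF that] M0[of j] by (simp add: norm_mult power2_eq_square)
    have nc: "norm (c j) = M j ^ 2" by (simp add: c_def norm_power)
    have tri: "norm (a + b - 5 * d) \<le> norm a + norm b + 5 * norm d" for a b d :: complex
      using norm_triangle_ineq4[of "a + b" "5 * d"] norm_triangle_ineq[of a b] by (simp add: norm_mult)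
    have "norm (u1 j x * v1 j y + v1 j x * u1 j y - 5 * (u1 j x * u1 j y))
        \<le> 9 * M j ^ 2 + 9 * M j ^ 2 + 45 * M j ^ 2"
      using tri[of "u1 j x * v1 j y" "v1 j x * u1 j y" "u1 j x * u1 j y"]
        p[OF u(3)[of j x] v(3)[of j y]] p[OF v(3)[of j x] u(3)[of j y]] p[OF u(3)[of j x] u(3)[of j y]]
      by linarith
    then show "norm ((u1 j x * v1 j y + v1 j x * u1 j y - 5 * (u1 j x * u1 j y)) / c j)
        \<le> (9 * M j ^ 2 + 9 * M j ^ 2 + 45 * M j ^ 2) / M j ^ 2"
      unfolding norm_divide nc by (rule divide_right_mono) simp
  qed
  \<comment> \<open>In units of \<open>M j\<close>, the slopes at 0 are \<open>\<i>\<close> and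
    \<open>2 * \<i>\<close>, so the value is \<open>- 2 - 2 + 5\<close>.\<close>
  have "(u1 j 0 * v1 j 0 + v1 j 0 * u1 j 0 - 5 * (u1 j 0 * u1 j 0)) / c j = 1" for j
    using M0[of j] by (simp add: u(5) v(5) c_def field_simps power2_eq_square)
  then have xy0: "T u1 v1 u1 v1 (0, 0) = of_nat N"
    by (simp add: T_def)
  have yy: "norm (T u v u2 v2 (x, y)) \<le> 80 * sqrt N" for x y
    using xx[of y x] by (simp add: sym[of u v])
  show ?thesis
    by (rule that[OF spec[unfolded K_def] Tx[OF u(1) v(1)] Tx[OF u(2) v(2)]
          Ty[OF u(1) v(1)] Ty[OF u(2) v(2)] Tx[OF u(1) v(1)] _ _ _ xy0])
       (use xx yy xy_bound in blast)+
qed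

lemma unbounded_mixed_derivative:
  assumes N: "N \<ge> 1" and n: "8 ^ N\<^sup>2 \<le> n"
  obtains P where "analytic_trig_poly P" "trig_degree P = n"
    "sup_norm (partial_x (partial_x (trig_fun P))) + sup_norm (partial_y (partial_y (trig_fun P))) \<le> 1"
    "sup_norm (partial_x (partial_y (trig_fun P))) \<ge> sqrt N / 161"
proof -
  \<comment> \<open>This choice gives \<open>N \<le> L\<close> for the error terms,
    \<open>8 \<le> L\<close> for the degree, and \<open>L ^ N = 8 ^ N\<^sup>2\<close>, which the
    hypothesis compares with \<open>n\<close>.\<close>
  define L where "L = (8 :: nat) ^ N"
  have "N < 2 ^ N" by (rule less_exp)
  also have "(2 :: nat) ^ N \<le> 8 ^ N" by (rule power_mono) auto
  finally have NL: "N \<le> L" by (simp add: L_def)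
  have "(8 :: nat) ^ 1 \<le> 8 ^ N" by (rule power_increasing) (use N in auto)
  then have L8: "8 \<le> L" by (simp add: L_def)
  then have "2 \<le> L" by simp
  obtain Q Qx Qxx Qy Qyy Qxy B where Q:
    "spectrum_in ({1..3 * int (L ^ (N - 1))} \<times> {1..3 * int (L ^ (N - 1))}) Q"
    "has_partial_x Q Qx" "has_partial_x Qx Qxx" "has_partial_y Q Qy" "has_partial_y Qy Qyy"
    "has_partial_x Qy Qxy"
    "\<forall>x y. norm (Qxx (x, y)) \<le> 80 * sqrt N" "\<forall>x y. norm (Qyy (x, y)) \<le> 80 * sqrt N"
    "\<forall>x y. norm (Qxy (x, y)) \<le> B" "Qxy (0, 0) = of_nat N"
    by (rule riesz_sum_derivatives[OF \<open>2 \<le> L\<close> NL N])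
  \<comment> \<open>The two frequencies of \<open>Q\<close> add up to at most
    \<open>6 * L ^ (N - 1)\<close>, so this bound places the spectrum in the triangle.\<close>
  have "8 * L ^ (N - 1) \<le> L * L ^ (N - 1)" using L8 by (rule mult_right_mono) simp
  also have "\<dots> = L ^ N" using N by (simp add: power_eq_if)
  also have "\<dots> = 8 ^ N\<^sup>2" by (simp add: L_def power_mult[symmetric] power2_eq_square)
  finally have "8 * L ^ (N - 1) \<le> n" using n by simp
  then have "int (8 * L ^ (N - 1)) \<le> int n" by (simp only: of_nat_le_iff)
  then have Ln: "8 * int (L ^ (N - 1)) \<le> int n" by (simp only: of_nat_mult of_nat_numeral)
  have L0: "int (L ^ (N - 1)) \<ge> 0" by simp
  have n0: "n \<ge> 1" using order.trans[OF _ n, of 1] by simp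
  \<comment> \<open>The pure derivatives use \<open>80 + 80\<close> multiples of
    \<open>sqrt N\<close>; one more absorbs the monomial, since
    \<open>1 \<le> sqrt N\<close>.\<close>
  define s where "s = 161 * sqrt N"
  have s0: "s > 0" using N by (simp add: s_def)
  define a where "a = complex_of_real (1 / s)"
  \<comment> \<open>Two derivatives in \<open>x\<close> multiply the monomial by
    \<open>- (real n)\<^sup>2\<close>, leaving norm \<open>1 / s\<close>. It is constant in
    \<open>y\<close>, so the other two second derivatives do not see it.\<close>
  define e where "e = complex_of_real (1 / (s * (real n)\<^sup>2))"
  have e0: "e \<noteq> 0" using s0 n0 by (simp add: e_def)
  have "spectrum_in {(k, l). 1 \<le> k \<and> 1 \<le> l \<and> k + l \<le> int n} Q"
    by (rule spectrum_in_mono[OF Q(1) _ finite_int_triangle]) (use Ln L0 in auto)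
  then have "spectrum_in {(k, l). 1 \<le> k \<and> 1 \<le> l \<and> k + l \<le> int n} (\<lambda>p. a * Q p)"
    by (rule spectrum_in_cmult)
  then obtain P where P: "analytic_trig_poly P" "trig_degree P = n"
    "\<forall>x y. trig_fun P (x, y) = a * Q (x, y) + e * cis (real n * x)"
    by (rule trig_poly_of_spectrum[OF _ e0])
  define g where "g = (\<lambda>(x :: real, y :: real). e * cis (real n * x))"
  have tP: "trig_fun P = (\<lambda>p. a * Q p + g p)"
    by (rule ext) (auto simp: P(3) g_def)
  have gx: "has_partial_x g (\<lambda>p. \<i> * real n * g p)"
    unfolding has_partial_x_def g_def case_prod_conv
    by (intro allI, rule has_vector_derivative_eq_rhs[OF has_vector_derivative_mult_right[OF
          has_vector_derivative_cis]])
       (simp add: mult_ac)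
  have gxx: "has_partial_x (\<lambda>p. \<i> * real n * g p) (\<lambda>p. - (real n)\<^sup>2 * g p)"
    unfolding has_partial_x_def g_def case_prod_conv
    by (intro allI, rule has_vector_derivative_eq_rhs[OF has_vector_derivative_mult_right[OF
          has_vector_derivative_mult_right[OF has_vector_derivative_cis]]])
       (simp add: power2_eq_square mult_ac)
  have gy: "has_partial_y g (\<lambda>p. 0)" and zy: "has_partial_y (\<lambda>p. 0) (\<lambda>p. 0)"
    and zx: "has_partial_x (\<lambda>p. 0) (\<lambda>p. 0)"
    unfolding has_partial_x_def has_partial_y_def g_def by simp_all
  have px: "partial_x (trig_fun P) = (\<lambda>p. a * Qx p + \<i> * real n * g p)"
    unfolding tP by (intro partial_x_eq has_partial_x_add_cmult Q gx)
  \<comment> \<open>The summand \<open>0\<close> keeps the shape \<open>a * f p + g p\<close> for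
    the next differentiation.\<close>
  have py: "partial_y (trig_fun P) = (\<lambda>p. a * Qy p + 0)"
    unfolding tP by (intro partial_y_eq has_partial_y_add_cmult Q gy)
  have pxx: "partial_x (partial_x (trig_fun P)) = (\<lambda>p. a * Qxx p + (- (real n)\<^sup>2 * g p))"
    unfolding px by (intro partial_x_eq has_partial_x_add_cmult Q gxx)
  have pyy: "partial_y (partial_y (trig_fun P)) = (\<lambda>p. a * Qyy p + 0)"
    unfolding py by (intro partial_y_eq has_partial_y_add_cmult Q zy)
  have pxy: "partial_x (partial_y (trig_fun P)) = (\<lambda>p. a * Qxy p + 0)"
    unfolding py by (intro partial_x_eq has_partial_x_add_cmult Q zx)
  have na: "norm a = 1 / s" using s0 by (simp add: a_def norm_divide)
  have ng: "norm (- (real n)\<^sup>2 * g (x, y)) = 1 / s" for x y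
    using s0 n0 by (simp add: g_def e_def norm_mult norm_power norm_divide)
  have xx: "sup_norm (partial_x (partial_x (trig_fun P))) \<le> (80 * sqrt N + 1) / s"
    unfolding pxx
  proof (rule sup_norm_le)
    fix x y
    have "norm (a * Qxx (x, y) + (- (real n)\<^sup>2 * g (x, y))) \<le> norm (a * Qxx (x, y)) + 1 / s"
      using norm_triangle_ineq[of "a * Qxx (x, y)" "- (real n)\<^sup>2 * g (x, y)"] ng[of x y] by simp
    also have "norm (a * Qxx (x, y)) \<le> 80 * sqrt N / s"
      using Q(7)[rule_format, of x y] s0 by (simp add: norm_mult na divide_right_mono)
    finally show "norm (a * Qxx (x, y) + (- (real n)\<^sup>2 * g (x, y))) \<le> (80 * sqrt N + 1) / s"
      by (simp add: add_divide_distrib)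
  qed
  have yy: "sup_norm (partial_y (partial_y (trig_fun P))) \<le> 80 * sqrt N / s"
    unfolding pyy using Q(8) s0 by (intro sup_norm_le) (simp add: norm_mult na divide_right_mono)
  have "(80 * sqrt N + 1) / s + 80 * sqrt N / s = (160 * sqrt N + 1) / s"
    by (simp add: add_divide_distrib)
  also have "\<dots> \<le> 1" using s0 N by (simp add: s_def)
  finally have le1: "(80 * sqrt N + 1) / s + 80 * sqrt N / s \<le> 1" .
  have "norm (partial_x (partial_y (trig_fun P)) (0, 0)) \<le> sup_norm (partial_x (partial_y (trig_fun P)))"
  proof (rule sup_norm_ge)
    show "norm (partial_x (partial_y (trig_fun P)) (x, y)) \<le> B / s" for x y
      unfolding pxy using Q(9) s0 by (simp add: norm_mult na divide_right_mono)
  qed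
  also have "norm (partial_x (partial_y (trig_fun P)) (0, 0)) = N / s"
    by (simp add: pxy norm_mult na Q(10))
  also have "real N / s = sqrt N / 161"
    using N by (simp add: s_def field_simps)
  finally have xy: "sqrt N / 161 \<le> sup_norm (partial_x (partial_y (trig_fun P)))" .
  show ?thesis
    by (rule that[OF P(1,2) _ xy]) (use xx yy le1 in linarith)
qed

text \<open>For degrees too small for the Riesz construction, the character of frequency
  \<open>(1, n - 1)\<close> divided by \<open>(real n)\<^sup>2\<close> does, because
  \<open>1 + (n - 1)\<^sup>2 \<le> n\<^sup>2\<close>.\<close>

lemma monomial_mixed_derivative:
  assumes n: "n \<ge> 1"
  obtains P where "analytic_trig_poly P" "trig_degree P = n"
    "sup_norm (partial_x (partial_x (trig_fun P))) + sup_norm (partial_y (partial_y (trig_fun P))) \<le> 1"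
    "sup_norm (partial_x (partial_y (trig_fun P))) \<ge> real (n - 1) / (real n)\<^sup>2"
proof -
  define m where "m = real (n - 1)"
  have m: "m \<ge> 0" "real n = m + 1" using n by (simp_all add: m_def)
  let ?e = "\<lambda>(x, y). cis (1 * x) * cis (m * y)"
  define c where "c = complex_of_real (1 / (real n)\<^sup>2)"
  define P where "P = Poly_Mapping.single (1 :: int, int (n - 1)) c"
  have c: "c \<noteq> 0" "norm c = 1 / (real n)\<^sup>2" using n by (simp_all add: c_def norm_divide norm_power)
  have tP: "trig_fun P = (\<lambda>p. c * ?e p)"
    using c by (intro ext) (auto simp: trig_fun_cis P_def m_def cis_mult)
  have hx: "has_partial_x (\<lambda>p. b * ?e p) (\<lambda>p. (b * \<i>) * ?e p)" for b
    unfolding has_partial_x_def case_prod_conv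
    by (intro allI, rule has_vector_derivative_eq_rhs[OF has_vector_derivative_mult_right[OF
          has_vector_derivative_mult_left[OF has_vector_derivative_cis]]])
       (simp add: mult_ac)
  have hy: "has_partial_y (\<lambda>p. b * ?e p) (\<lambda>p. (b * (\<i> * m)) * ?e p)" for b
    unfolding has_partial_y_def case_prod_conv
    by (intro allI, rule has_vector_derivative_eq_rhs[OF has_vector_derivative_mult_right[OF
          has_vector_derivative_mult_right[OF has_vector_derivative_cis]]])
       (simp add: mult_ac)
  note d = tP partial_x_eq[OF hx] partial_y_eq[OF hy]
  have ne: "norm (b * ?e (x, y)) = norm b" for b x y
    by (simp add: norm_mult)
  have "sup_norm (partial_x (partial_x (trig_fun P))) \<le> 1 / (real n)\<^sup>2"
    unfolding d by (rule sup_norm_le) (simp add: norm_mult c)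
  moreover have "sup_norm (partial_y (partial_y (trig_fun P))) \<le> m\<^sup>2 / (real n)\<^sup>2"
    unfolding d by (rule sup_norm_le) (use m in \<open>simp add: norm_mult c power2_eq_square\<close>)
  moreover have "1 + m\<^sup>2 \<le> (real n)\<^sup>2"
    using m by (simp add: power2_sum)
  then have "1 / (real n)\<^sup>2 + m\<^sup>2 / (real n)\<^sup>2 \<le> 1"
    using n by (simp add: add_divide_distrib[symmetric])
  ultimately have le: "sup_norm (partial_x (partial_x (trig_fun P)))
      + sup_norm (partial_y (partial_y (trig_fun P))) \<le> 1"
    by linarith
  have "norm (partial_x (partial_y (trig_fun P)) (0, 0)) \<le> sup_norm (partial_x (partial_y (trig_fun P)))"
    unfolding d by (rule sup_norm_ge[of _ "m / (real n)\<^sup>2"]) (use m in \<open>simp add: norm_mult c\<close>)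
  moreover have "m / (real n)\<^sup>2 \<le> norm (partial_x (partial_y (trig_fun P)) (0, 0))"
    unfolding d using m by (simp add: norm_mult c)
  ultimately have xy: "real (n - 1) / (real n)\<^sup>2 \<le> sup_norm (partial_x (partial_y (trig_fun P)))"
    unfolding m_def by linarith
  have keys: "Poly_Mapping.keys P = {(1, int (n - 1))}"
    using c by (simp add: P_def)
  have an: "analytic_trig_poly P"
    by (auto simp: analytic_trig_poly_def P_def lookup_single when_def)
  have "trig_degree P = n"
    using n by (simp add: trig_degree_def keys)
  then show ?thesis
    by (rule that[OF an _ le xy])
qed

theorem corollary4:
  "\<exists>c0::real. c0 > 0 \<and> (\<forall>n::nat. n \<ge> 1 \<longrightarrow>
     (\<exists>P :: trig_poly. analytic_trig_poly P \<and> trig_degree P = n \<and>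
        sup_norm (partial_x (partial_x (trig_fun P)))
          + sup_norm (partial_y (partial_y (trig_fun P))) \<le> 1 \<and>
        sup_norm (partial_x (partial_y (trig_fun P))) \<ge> c0 * (ln (real n)) powr (1/8)))"
proof -
  \<comment> \<open>The constant is half of \<open>1 / 161\<close>, since for
    \<open>n \<ge> 8\<close> the quantity \<open>ln n powr (1/8)\<close> is at most
    \<open>2 * sqrt N\<close>. For \<open>n < 8\<close> no \<open>N \<ge> 1\<close> satisfies
    \<open>8 ^ N\<^sup>2 \<le> n\<close>.\<close>
  have "\<exists>P. analytic_trig_poly P \<and> trig_degree P = n \<and>
      sup_norm (partial_x (partial_x (trig_fun P))) + sup_norm (partial_y (partial_y (trig_fun P))) \<le> 1 \<and>
      sup_norm (partial_x (partial_y (trig_fun P))) \<ge> 1 / 322 * ln (real n) powr (1/8)"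
    if n: "n \<ge> 1" for n
  proof (cases "n < 8")
    case True
    obtain P where P: "analytic_trig_poly P" "trig_degree P = n"
      "sup_norm (partial_x (partial_x (trig_fun P))) + sup_norm (partial_y (partial_y (trig_fun P))) \<le> 1"
      "sup_norm (partial_x (partial_y (trig_fun P))) \<ge> real (n - 1) / (real n)\<^sup>2"
      by (rule monomial_mixed_derivative[OF n])
    have "1 / 322 * ln (real n) powr (1/8) \<le> real (n - 1) / (real n)\<^sup>2"
    \<comment> \<open>At \<open>n = 1\<close> both sides are 0. Otherwise
      \<open>7 \<le> 2 ^ 8\<close> bounds the left side by \<open>2 / 322\<close>, which is below
      \<open>1 / 64\<close>.\<close>
    proof (cases "n = 1")
      case False
      have "ln (real n) \<le> 7" "0 \<le> ln (real n)"
        using True n ln_le_minus_one[of "real n"] by simp_all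
      then have "ln (real n) powr (1/8) \<le> (2 ^ 8) powr (1/8)"
        by (intro powr_mono2) auto
      also have "(2 ^ 8) powr (1/8) = (2 :: real)"
        by (simp add: powr_powr flip: powr_realpow)
      finally have "1 / 322 * ln (real n) powr (1/8) \<le> 1 / 8\<^sup>2" by simp
      also have "\<dots> \<le> real (n - 1) / (real n)\<^sup>2"
        using False True n by (intro frac_le power_mono) auto
      finally show ?thesis .
    qed simp
    then show ?thesis using P order.trans by blast
  next
    case False
    \<comment> \<open>The largest \<open>N\<close> with \<open>8 ^ N\<^sup>2 \<le> n\<close>;
      rounding down costs at most a factor 2, as \<open>N + 1 \<le> 2 * N\<close>.\<close>
    define N where "N = nat \<lfloor>sqrt (log 8 n)\<rfloor>"
    have l1: "log 8 n \<ge> 1" using False by simp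
    then have "sqrt (log 8 n) \<ge> 1" by simp
    then have N1: "N \<ge> 1" unfolding N_def by linarith
    have Nle: "real N \<le> sqrt (log 8 n)" "sqrt (log 8 n) \<le> real N + 1"
      using \<open>sqrt (log 8 n) \<ge> 1\<close> unfolding N_def by linarith+
    have "real N ^ 2 \<le> log 8 n"
      using power_mono[OF Nle(1), of 2] l1 by simp
    then have "8 powr (real (N\<^sup>2)) \<le> n"
      using n by (subst (asm) le_log_iff) auto
    then have "(8 :: real) ^ N\<^sup>2 \<le> n"
      using powr_realpow[of 8 "N\<^sup>2"] by simp
    then have nN: "8 ^ N\<^sup>2 \<le> n"
      by (metis of_nat_le_iff of_nat_numeral of_nat_power)
    obtain P where P: "analytic_trig_poly P" "trig_degree P = n"
      "sup_norm (partial_x (partial_x (trig_fun P))) + sup_norm (partial_y (partial_y (trig_fun P))) \<le> 1"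
      "sup_norm (partial_x (partial_y (trig_fun P))) \<ge> sqrt N / 161"
      by (rule unbounded_mixed_derivative[OF N1 nN])
    have "sqrt (log 8 n) \<le> 2 * real N" using Nle(2) N1 by simp
    then have "log 8 n \<le> (2 * real N)\<^sup>2"
      by (rule sqrt_le_D)
    \<comment> \<open>Here growth is given away: the exponent \<open>1/8\<close> only asks for
      \<open>N ^ 4\<close>, the eighth power of \<open>sqrt N\<close>.\<close>
    also have "\<dots> \<le> 4 * real N ^ 4"
      using power_increasing[of 2 4 "real N"] N1 by (simp add: power_mult_distrib)
    finally have lN: "log 8 n \<le> 4 * real N ^ 4" .
    have "ln 8 = ln ((2::real) ^ 3)" by simp
    also have "\<dots> \<le> 3" using ln_le_minus_one[of "2::real"] by (subst ln_realpow) auto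
    finally have l8: "ln (8::real) \<le> 3" .
    have "ln n = log 8 n * ln 8" by (simp add: log_def)
    also have "\<dots> \<le> (4 * real N ^ 4) * 3"
      using lN l8 l1 by (intro mult_mono) auto
    \<comment> \<open>The factor 12 is raised to \<open>2 ^ 8\<close> so that the whole bound is an
      eighth power.\<close>
    also have "\<dots> \<le> 2 ^ 8 * real N ^ 4" by simp
    also have "\<dots> = (2 * sqrt N) ^ 8"
    proof -
      have "sqrt N ^ (2 * 4) = (sqrt N ^ 2) ^ 4" by (rule power_mult)
      then show ?thesis by (simp add: power_mult_distrib)
    qed
    finally have "ln n \<le> (2 * sqrt N) ^ 8" .
    then have "ln n powr (1/8) \<le> ((2 * sqrt N) ^ 8) powr (1/8)"
      using n by (intro powr_mono2) auto
    also have "\<dots> = 2 * sqrt N"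
    proof -
      have pos: "2 * sqrt N > 0" using N1 by simp
      show ?thesis
        unfolding powr_realpow[OF pos, symmetric] powr_powr using pos by simp
    qed
    finally have "1 / 322 * ln n powr (1/8) \<le> sqrt N / 161" by simp
    then show ?thesis using P order.trans by blast
  qed
  then show ?thesis by (intro exI[of _ "1 / 322"]) simp
qed

end
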